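(* Let $H^{m',n'}_{p',q'}\left[t\,\Big|\begin{array}{c}(\alpha'_j,A'_j)_1^{p'}\\(\beta'_j,B'_j)_1^{q'}\end{array}\right]$ be a Fox $H$-function with real $\alpha'_j,\beta'_j$ and positive $A'_j,B'_j$ which is defined and positive for every $t>0$. Then $$H^{m'',n''}_{p'',q''}\left[t\,\Big|\begin{array}{c}(\alpha''_j,A''_j)_1^{p''}\\(\beta''_j,B''_j)_1^{q''}\end{array}\right]>0\qquad\text{for every }t>0$$ if any of the following sets of conditions holds, for any $\omega>0$: (1) $m''=n'$, $n''=m'$, $p''=q'$, $q''=p'$, $(\alpha''_j,A''_j)_1^{q'}=(1-\beta'_j,B'_j)_1^{q'}$, $(\beta''_j,B''_j)_1^{p'}=(1-\alpha'_j,A'_j)_1^{p'}$; (2) $m''=m'$, $n''=n'$, $p''=p'$, $q''=q'$, $(\alpha''_j,A''_j)_1^{p'}=(\alpha'_j,\omega A'_j)_1^{p'}$, $(\beta''_j,B''_j)_1^{q'}=(\beta'_j,\omega B'_j)_1^{q'}$; (3) $m''=m'$, $n''=n'$, $p''=p'$, $q''=q'$, $(\alpha''_j,A''_j)_1^{p'}=(\alpha'_j\pm\omega A'_j,A'_j)_1^{p'}$, $(\beta''_j,B''_j)_1^{q'}=(\beta'_j\pm\omega B'_j,B'_j)_1^{q'}$ (same choice of sign in both lists, either sign being allowed).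
   Context: $\mathbb{N}_0=\{0,1,2,\dots\}$. The notation $(x_j,X_j)_1^l$ stands for the list $(x_1,X_1),\dots,(x_l,X_l)$ (the empty list if $l=0$). Fox $H$-function. For $0\le n\le p$, $0\le m\le q$, $A_j,B_j>0$, $\alpha_j,\beta_j\in\mathbb{C}$ with $A_j(l+\beta_{j'})\ne B_{j'}(\alpha_j-l'-1)$ for all $1\le j\le n$, $1\le j'\le m$, $l,l'\in\mathbb{N}_0$, put $$\Xi^{m,n}_{p,q}(s)=\frac{\prod_{j=1}^m\Gamma(\beta_j+B_js)\prod_{j=1}^n\Gamma(1-\alpha_j-A_js)}{\prod_{j=m+1}^q\Gamma(1-\beta_j-B_js)\prod_{j=n+1}^p\Gamma(\alpha_j+A_js)}$$ (empty products are $1$), and $$H^{m,n}_{p,q}\left[z\,\Big|\begin{array}{c}(\alpha_j,A_j)_1^p\\(\beta_j,B_j)_1^q\end{array}\right]=\frac{1}{2\pi i}\int_{\mathcal C}\Xi^{m,n}_{p,q}(s)\,z^{-s}\,ds\qquad(z>0).$$ Here $\mathcal C$ is a contour leaving all poles of $\Gamma(\beta_j+B_js)$, $1\le j\le m$, on its left and all poles of $\Gamma(1-\alpha_j-A_js)$, $1\le j\le n$, on its right, of one of the following types for which the integral converges: a contour from $\gamma-i\infty$ to $\gamma+i\infty$ with $\gamma\in\mathbb{R}$; a loop in a horizontal strip from $-\infty+i\varphi_1$ to $-\infty+i\varphi_2$, $\varphi_1<\varphi_2$; or a loop in a horizontal strip from $+\infty+i\varphi_1$ to $+\infty+i\varphi_2$,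 $\varphi_1<\varphi_2$. *)

theory Defs
  imports "HOL-Complex_Analysis.Complex_Analysis" "HOL-Library.Complex_Order"
begin

text \<open>
  Parameter lists of length \<open>p\<close> and \<open>q\<close> are encoded as functions on \<open>nat\<close>, of which only the
  values at \<open>1, \<dots>, p\<close> and \<open>1, \<dots>, q\<close> are used.
\<close>

definition fox_params ::
  "nat \<Rightarrow> nat \<Rightarrow> nat \<Rightarrow> nat \<Rightarrow> (nat \<Rightarrow> complex) \<Rightarrow> (nat \<Rightarrow> real) \<Rightarrow> (nat \<Rightarrow> complex) \<Rightarrow> (nat \<Rightarrow> real) \<Rightarrow> bool"
  where
  "fox_params m n p q \<alpha> A \<beta> B \<longleftrightarrow>
     n \<le> p \<and> m \<le> q \<and> (\<forall>j\<in>{1..p}. A j > 0) \<and> (\<forall>j\<in>{1..q}. B j > 0) \<and>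
     (\<forall>j\<in>{1..n}. \<forall>j'\<in>{1..m}. \<forall>l l' :: nat.
        complex_of_real (A j) * (of_nat l + \<beta> j') \<noteq> complex_of_real (B j') * (\<alpha> j - of_nat l' - 1))"

text \<open>
  A pole of a Gamma factor in the denominator makes \<open>\<Xi>\<close> vanish; this is what the conventions
  \<open>Gamma x = 0\<close> at the poles and \<open>c / 0 = 0\<close> yield.
\<close>

definition fox_Xi ::
  "nat \<Rightarrow> nat \<Rightarrow> nat \<Rightarrow> nat \<Rightarrow> (nat \<Rightarrow> complex) \<Rightarrow> (nat \<Rightarrow> real) \<Rightarrow> (nat \<Rightarrow> complex) \<Rightarrow> (nat \<Rightarrow> real)
    \<Rightarrow> complex \<Rightarrow> complex" where
  "fox_Xi m n p q \<alpha> A \<beta> B s =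
     ((\<Prod>j=1..m. Gamma (\<beta> j + of_real (B j) * s)) *
      (\<Prod>j=1..n. Gamma (1 - \<alpha> j - of_real (A j) * s))) /
     ((\<Prod>j=m+1..q. Gamma (1 - \<beta> j - of_real (B j) * s)) *
      (\<Prod>j=n+1..p. Gamma (\<alpha> j + of_real (A j) * s)))"

text \<open>
  Contours are simple, piecewise continuously differentiable curves parametrised by the whole
  real line.  In the two loop cases the conditions at both ends, together with continuity,
  confine the curve to a horizontal strip.
\<close>

definition simple_contour :: "(real \<Rightarrow> complex) \<Rightarrow> bool" where
  "simple_contour g \<longleftrightarrow> inj g \<and> (\<forall>a b. g piecewise_C1_differentiable_on {a..b})"

definition vertical_ends :: "(real \<Rightarrow> complex) \<Rightarrow> real \<Rightarrow> bool" where
  "vertical_ends g \<gamma> \<longleftrightarrow>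
     ((\<lambda>\<tau>. Re (g \<tau>)) \<longlongrightarrow> \<gamma>) at_bot \<and> filterlim (\<lambda>\<tau>. Im (g \<tau>)) at_bot at_bot \<and>
     ((\<lambda>\<tau>. Re (g \<tau>)) \<longlongrightarrow> \<gamma>) at_top \<and> filterlim (\<lambda>\<tau>. Im (g \<tau>)) at_top at_top"

definition left_loop_ends :: "(real \<Rightarrow> complex) \<Rightarrow> real \<Rightarrow> real \<Rightarrow> bool" where
  "left_loop_ends g \<phi>1 \<phi>2 \<longleftrightarrow> \<phi>1 < \<phi>2 \<and>
     filterlim (\<lambda>\<tau>. Re (g \<tau>)) at_bot at_bot \<and> ((\<lambda>\<tau>. Im (g \<tau>)) \<longlongrightarrow> \<phi>1) at_bot \<and>
     filterlim (\<lambda>\<tau>. Re (g \<tau>)) at_bot at_top \<and> ((\<lambda>\<tau>. Im (g \<tau>)) \<longlongrightarrow> \<phi>2) at_top"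

definition right_loop_ends :: "(real \<Rightarrow> complex) \<Rightarrow> real \<Rightarrow> real \<Rightarrow> bool" where
  "right_loop_ends g \<phi>1 \<phi>2 \<longleftrightarrow> \<phi>1 < \<phi>2 \<and>
     filterlim (\<lambda>\<tau>. Re (g \<tau>)) at_top at_bot \<and> ((\<lambda>\<tau>. Im (g \<tau>)) \<longlongrightarrow> \<phi>1) at_bot \<and>
     filterlim (\<lambda>\<tau>. Re (g \<tau>)) at_top at_top \<and> ((\<lambda>\<tau>. Im (g \<tau>)) \<longlongrightarrow> \<phi>2) at_top"

text \<open>
  The complement of a contour has two components, one on each side.  The left (right) one is
  singled out as the component that contains all points of the line \<open>Im s = h\<close> with
  sufficiently small (large) real part.  The height \<open>h\<close> must lie strictly between the heights
  of the two ends in the case of a loop, and is arbitrary for a vertical contour.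
\<close>

definition left_side :: "(real \<Rightarrow> complex) \<Rightarrow> real \<Rightarrow> complex set" where
  "left_side g h = {s. \<forall>\<^sub>F x in at_bot. connected_component (- range g) s (Complex x h)}"

definition right_side :: "(real \<Rightarrow> complex) \<Rightarrow> real \<Rightarrow> complex set" where
  "right_side g h = {s. \<forall>\<^sub>F x in at_top. connected_component (- range g) s (Complex x h)}"

definition separates_poles ::
  "nat \<Rightarrow> nat \<Rightarrow> (nat \<Rightarrow> complex) \<Rightarrow> (nat \<Rightarrow> real) \<Rightarrow> (nat \<Rightarrow> complex) \<Rightarrow> (nat \<Rightarrow> real)
    \<Rightarrow> (real \<Rightarrow> complex) \<Rightarrow> real \<Rightarrow> bool" where
  "separates_poles m n \<alpha> A \<beta> B g h \<longleftrightarrow>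
     (\<forall>j\<in>{1..m}. \<forall>s. is_pole (\<lambda>s. Gamma (\<beta> j + of_real (B j) * s)) s \<longrightarrow> s \<in> left_side g h) \<and>
     (\<forall>j\<in>{1..n}. \<forall>s. is_pole (\<lambda>s. Gamma (1 - \<alpha> j - of_real (A j) * s)) s \<longrightarrow> s \<in> right_side g h)"

definition fox_contour ::
  "nat \<Rightarrow> nat \<Rightarrow> (nat \<Rightarrow> complex) \<Rightarrow> (nat \<Rightarrow> real) \<Rightarrow> (nat \<Rightarrow> complex) \<Rightarrow> (nat \<Rightarrow> real)
    \<Rightarrow> (real \<Rightarrow> complex) \<Rightarrow> bool" where
  "fox_contour m n \<alpha> A \<beta> B g \<longleftrightarrow> simple_contour g \<and>
     ((\<exists>\<gamma>. vertical_ends g \<gamma> \<and> separates_poles m n \<alpha> A \<beta> B g 0) \<or>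
      (\<exists>\<phi>1 \<phi>2. (left_loop_ends g \<phi>1 \<phi>2 \<or> right_loop_ends g \<phi>1 \<phi>2) \<and>
               separates_poles m n \<alpha> A \<beta> B g ((\<phi>1 + \<phi>2) / 2)))"

text \<open>
  The gauge integral over \<open>UNIV\<close> is the improper contour integral: it exists iff the integrals
  over \<open>{a..b}\<close> converge as \<open>a \<rightarrow> -\<infinity>\<close> and \<open>b \<rightarrow> \<infinity>\<close> independently,
  conditional convergence included.
\<close>

definition has_fox_H ::
  "nat \<Rightarrow> nat \<Rightarrow> nat \<Rightarrow> nat \<Rightarrow> (nat \<Rightarrow> complex) \<Rightarrow> (nat \<Rightarrow> real) \<Rightarrow> (nat \<Rightarrow> complex) \<Rightarrow> (nat \<Rightarrow> real)
    \<Rightarrow> real \<Rightarrow> complex \<Rightarrow> bool" where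
  "has_fox_H m n p q \<alpha> A \<beta> B z w \<longleftrightarrow>
     fox_params m n p q \<alpha> A \<beta> B \<and> z > 0 \<and>
     (\<exists>g I. fox_contour m n \<alpha> A \<beta> B g \<and>
        ((\<lambda>\<tau>. fox_Xi m n p q \<alpha> A \<beta> B (g \<tau>) * of_real z powr (- g \<tau>) *
              vector_derivative g (at \<tau>)) has_integral I) UNIV \<and>
        w = 1 / (2 * of_real pi * \<i>) * I)"

text \<open>
  The function is defined at \<open>z\<close> if the integral converges for some admissible contour, and
  its value does not depend on which of these contours is used.
\<close>

definition fox_H_defined ::
  "nat \<Rightarrow> nat \<Rightarrow> nat \<Rightarrow> nat \<Rightarrow> (nat \<Rightarrow> complex) \<Rightarrow> (nat \<Rightarrow> real) \<Rightarrow> (nat \<Rightarrow> complex) \<Rightarrow> (nat \<Rightarrow> real)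
    \<Rightarrow> real \<Rightarrow> bool" where
  "fox_H_defined m n p q \<alpha> A \<beta> B z \<longleftrightarrow> (\<exists>!w. has_fox_H m n p q \<alpha> A \<beta> B z w)"

definition fox_H ::
  "nat \<Rightarrow> nat \<Rightarrow> nat \<Rightarrow> nat \<Rightarrow> (nat \<Rightarrow> complex) \<Rightarrow> (nat \<Rightarrow> real) \<Rightarrow> (nat \<Rightarrow> complex) \<Rightarrow> (nat \<Rightarrow> real)
    \<Rightarrow> real \<Rightarrow> complex" where
  "fox_H m n p q \<alpha> A \<beta> B z = (THE w. has_fox_H m n p q \<alpha> A \<beta> B z w)"

text \<open>
  Positivity of a complex value is the order of \<^theory>\<open>HOL-Library.Complex_Order\<close>:
  the value is real and positive.
\<close>

definition fox_H_positive ::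
  "nat \<Rightarrow> nat \<Rightarrow> nat \<Rightarrow> nat \<Rightarrow> (nat \<Rightarrow> real) \<Rightarrow> (nat \<Rightarrow> real) \<Rightarrow> (nat \<Rightarrow> real) \<Rightarrow> (nat \<Rightarrow> real) \<Rightarrow> bool"
  where
  "fox_H_positive m n p q \<alpha> A \<beta> B \<longleftrightarrow>
     (\<forall>t>0. fox_H_defined m n p q (\<lambda>j. of_real (\<alpha> j)) A (\<lambda>j. of_real (\<beta> j)) B t \<and>
            0 < fox_H m n p q (\<lambda>j. of_real (\<alpha> j)) A (\<lambda>j. of_real (\<beta> j)) B t)"

end

theory Submission
  imports Defs "HOL-Real_Asymp.Real_Asymp"
begin

text \<open>
  All three operations come from a real affine substitution \<open>s \<mapsto> a s + b\<close> in the contour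
  integral: \<open>a = -1\<close>, \<open>b = 0\<close> for (1), \<open>a = 1 / \<omega>\<close>, \<open>b = 0\<close> for (2) and \<open>a = 1\<close>,
  \<open>b = \<mp>\<omega>\<close> for (3).  It maps admissible contours to admissible contours (reversed if
  \<open>a < 0\<close>) and yields \<open>H''(t) = H'(1/t)\<close>, \<open>H''(t) = H'(t powr (1 / \<omega>)) / \<omega>\<close> and
  \<open>H''(t) = t powr (\<plusminus>\<omega>) * H'(t)\<close>.  Since the inverse substitution is of the same form, definedness
  transfers as well.
\<close>

section \<open>Affine images of contours\<close>

text \<open>The factor \<open>sgn a\<close> reverses the contour if \<open>a < 0\<close>, restoring its orientation.\<close>

definition affine_contour :: "real \<Rightarrow> real \<Rightarrow> (real \<Rightarrow> complex) \<Rightarrow> real \<Rightarrow> complex" where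
  "affine_contour a b g = (\<lambda>\<tau>. of_real a * g (sgn a * \<tau>) + of_real b)"

lemma range_affine_contour:
  assumes "a \<noteq> 0"
  shows "range (affine_contour a b g) = (\<lambda>s. of_real a * s + of_real b) ` range g"
proof -
  have "range (\<lambda>\<tau>::real. sgn a * \<tau>) = UNIV"
    using assms by (intro surjI[of _ "\<lambda>\<tau>. sgn a * \<tau>"]) (auto simp: sgn_if)
  then have "range g = range (\<lambda>\<tau>. g (sgn a * \<tau>))"
    by (metis (no_types) image_image)
  then show ?thesis
    unfolding affine_contour_def by (simp add: image_image)
qed

lemma simple_contour_affine:
  assumes "simple_contour g" "a \<noteq> 0"
  shows "simple_contour (affine_contour a b g)"
  unfolding simple_contour_def
proof (intro conjI allI)
  have "inj g"
    using assms(1) by (simp add: simple_contour_def)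
  then show "inj (affine_contour a b g)"
    using \<open>a \<noteq> 0\<close> by (intro injI) (auto simp: affine_contour_def sgn_eq_0_iff dest: injD)
  fix u v
  \<comment> \<open>The interval with endpoints \<open>- \<bar>u\<bar> - \<bar>v\<bar>\<close> and
    \<open>\<bar>u\<bar> + \<bar>v\<bar>\<close> contains both \<open>{u..v}\<close> and its mirror
    image, which covers both signs of \<open>a\<close>. The \<open>+ 0\<close> gives the map the
    shape that \<open>piecewise_C1_differentiable_affine\<close> expects.\<close>
  have "\<exists>u' v'. (\<lambda>x. sgn a * x + 0) ` {u..v} \<subseteq> {u'..v'}"
    by (rule exI[of _ "- \<bar>u\<bar> - \<bar>v\<bar>"], rule exI[of _ "\<bar>u\<bar> + \<bar>v\<bar>"]) (auto simp: sgn_if)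
  then obtain u' v' where "(\<lambda>x. sgn a * x + 0) ` {u..v} \<subseteq> {u'..v'}" by blast
  then have "g piecewise_C1_differentiable_on (\<lambda>x. sgn a * x + 0) ` {u..v}"
    using assms(1) piecewise_C1_differentiable_on_subset unfolding simple_contour_def by blast
  from piecewise_C1_differentiable_affine[OF this]
  show "affine_contour a b g piecewise_C1_differentiable_on {u..v}"
    unfolding affine_contour_def o_def
    by (auto intro!: derivative_intros)
qed

section \<open>End behaviour of transformed contours\<close>

lemma filterlim_affine_at_top_bot:
  fixes a b :: real
  shows "a > 0 \<Longrightarrow> filterlim (\<lambda>x. a * x + b) at_top at_top"
    and "a > 0 \<Longrightarrow> filterlim (\<lambda>x. a * x + b) at_bot at_bot"
    and "a < 0 \<Longrightarrow> filterlim (\<lambda>x. a * x + b) at_bot at_top"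
    and "a < 0 \<Longrightarrow> filterlim (\<lambda>x. a * x + b) at_top at_bot"
  by real_asymp+

lemma filterlim_reverse:
  fixes f :: "real \<Rightarrow> 'a"
  shows "filterlim f F at_top \<Longrightarrow> filterlim (\<lambda>\<tau>. f (- \<tau>)) F at_bot"
    and "filterlim f F at_bot \<Longrightarrow> filterlim (\<lambda>\<tau>. f (- \<tau>)) F at_top"
  by (simp_all add: filterlim_compose[OF _ filterlim_uminus_at_top_at_bot]
      filterlim_compose[OF _ filterlim_uminus_at_bot_at_top])

text \<open>Reversal for \<open>a < 0\<close> exchanges the two ends of the parameter line, hence
  the change of filter. Premises such as \<open>G = at_top\<close> let a single assumption yield
  four introduction rules.\<close>

lemma filterlim_affine_contour:
  assumes "filterlim (\<lambda>\<tau>. f (of_real a * g \<tau> + of_real b)) F G"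
  shows "a > 0 \<Longrightarrow> G = at_top \<Longrightarrow> filterlim (\<lambda>\<tau>. f (affine_contour a b g \<tau>)) F at_top"
    and "a > 0 \<Longrightarrow> G = at_bot \<Longrightarrow> filterlim (\<lambda>\<tau>. f (affine_contour a b g \<tau>)) F at_bot"
    and "a < 0 \<Longrightarrow> G = at_bot \<Longrightarrow> filterlim (\<lambda>\<tau>. f (affine_contour a b g \<tau>)) F at_top"
    and "a < 0 \<Longrightarrow> G = at_top \<Longrightarrow> filterlim (\<lambda>\<tau>. f (affine_contour a b g \<tau>)) F at_bot"
  using assms filterlim_reverse[where f = "\<lambda>\<tau>. f (of_real a * g \<tau> + of_real b)" and F = F]
  by (simp_all add: affine_contour_def)

lemma filterlim_Re_Im_affine:
  fixes s :: "'a \<Rightarrow> complex"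
  shows "a > 0 \<Longrightarrow> filterlim (\<lambda>x. Re (s x)) at_top G
           \<Longrightarrow> filterlim (\<lambda>x. Re (of_real a * s x + of_real b)) at_top G"
    and "a > 0 \<Longrightarrow> filterlim (\<lambda>x. Re (s x)) at_bot G
           \<Longrightarrow> filterlim (\<lambda>x. Re (of_real a * s x + of_real b)) at_bot G"
    and "a < 0 \<Longrightarrow> filterlim (\<lambda>x. Re (s x)) at_top G
           \<Longrightarrow> filterlim (\<lambda>x. Re (of_real a * s x + of_real b)) at_bot G"
    and "a < 0 \<Longrightarrow> filterlim (\<lambda>x. Re (s x)) at_bot G
           \<Longrightarrow> filterlim (\<lambda>x. Re (of_real a * s x + of_real b)) at_top G"
    and "a > 0 \<Longrightarrow> filterlim (\<lambda>x. Im (s x)) at_top G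
           \<Longrightarrow> filterlim (\<lambda>x. Im (of_real a * s x + of_real b)) at_top G"
    and "a > 0 \<Longrightarrow> filterlim (\<lambda>x. Im (s x)) at_bot G
           \<Longrightarrow> filterlim (\<lambda>x. Im (of_real a * s x + of_real b)) at_bot G"
    and "a < 0 \<Longrightarrow> filterlim (\<lambda>x. Im (s x)) at_top G
           \<Longrightarrow> filterlim (\<lambda>x. Im (of_real a * s x + of_real b)) at_bot G"
    and "a < 0 \<Longrightarrow> filterlim (\<lambda>x. Im (s x)) at_bot G
           \<Longrightarrow> filterlim (\<lambda>x. Im (of_real a * s x + of_real b)) at_top G"
    and "((\<lambda>x. Re (s x)) \<longlongrightarrow> c) G
           \<Longrightarrow> ((\<lambda>x. Re (of_real a * s x + of_real b)) \<longlongrightarrow> a * c + b) G"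
    and "((\<lambda>x. Im (s x)) \<longlongrightarrow> c) G
           \<Longrightarrow> ((\<lambda>x. Im (of_real a * s x + of_real b)) \<longlongrightarrow> a * c) G"
  using filterlim_compose[OF filterlim_affine_at_top_bot(1)[of a b], of "\<lambda>x. Re (s x)" G]
    filterlim_compose[OF filterlim_affine_at_top_bot(2)[of a b], of "\<lambda>x. Re (s x)" G]
    filterlim_compose[OF filterlim_affine_at_top_bot(3)[of a b], of "\<lambda>x. Re (s x)" G]
    filterlim_compose[OF filterlim_affine_at_top_bot(4)[of a b], of "\<lambda>x. Re (s x)" G]
    filterlim_compose[OF filterlim_affine_at_top_bot(1)[of a 0], of "\<lambda>x. Im (s x)" G]
    filterlim_compose[OF filterlim_affine_at_top_bot(2)[of a 0], of "\<lambda>x. Im (s x)" G]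
    filterlim_compose[OF filterlim_affine_at_top_bot(3)[of a 0], of "\<lambda>x. Im (s x)" G]
    filterlim_compose[OF filterlim_affine_at_top_bot(4)[of a 0], of "\<lambda>x. Im (s x)" G]
  by (simp_all add: tendsto_intros)

lemma vertical_ends_affine:
  assumes "vertical_ends g \<gamma>" "a \<noteq> 0"
  shows "vertical_ends (affine_contour a b g) (a * \<gamma> + b)"
proof -
  from \<open>a \<noteq> 0\<close> consider "a > 0" | "a < 0" by linarith
  then show ?thesis
    using assms(1) unfolding vertical_ends_def
    by cases (blast intro: filterlim_affine_contour filterlim_Re_Im_affine)+
qed

text \<open>For \<open>a < 0\<close> the loop opens to the other side. Because the parameter is
  reversed it starts at height \<open>a * \<phi>2\<close>, now the smaller one, so the loop still
  runs from its lower to its upper end.\<close>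

lemma left_loop_ends_affine:
  assumes "left_loop_ends g \<phi>1 \<phi>2"
  shows "a > 0 \<Longrightarrow> left_loop_ends (affine_contour a b g) (a * \<phi>1) (a * \<phi>2)"
    and "a < 0 \<Longrightarrow> right_loop_ends (affine_contour a b g) (a * \<phi>2) (a * \<phi>1)"
  using assms unfolding left_loop_ends_def right_loop_ends_def
  by (auto intro: filterlim_affine_contour filterlim_Re_Im_affine)

lemma right_loop_ends_affine:
  assumes "right_loop_ends g \<phi>1 \<phi>2"
  shows "a > 0 \<Longrightarrow> right_loop_ends (affine_contour a b g) (a * \<phi>1) (a * \<phi>2)"
    and "a < 0 \<Longrightarrow> left_loop_ends (affine_contour a b g) (a * \<phi>2) (a * \<phi>1)"
  using assms unfolding left_loop_ends_def right_loop_ends_def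
  by (auto intro: filterlim_affine_contour filterlim_Re_Im_affine)

section \<open>Sides of a contour and location of poles\<close>

text \<open>The substitution is a homeomorphism of the plane, so it carries connected sets avoiding
  the contour to connected sets avoiding its image. The filters stay arbitrary so that both sides of
  the contour and both signs of \<open>a\<close> are instances.\<close>

lemma eventually_component_affine:
  assumes ev: "\<forall>\<^sub>F x in F. connected_component (- range g) s (Complex x h)"
    and lim: "filterlim (\<lambda>x. x / a - b / a) F G"
    and "a \<noteq> 0"
  shows "\<forall>\<^sub>F x in G. connected_component (- range (affine_contour a b g))
           (of_real a * s + of_real b) (Complex x (a * h))"
proof -
  let ?f = "\<lambda>s::complex. of_real a * s + of_real b"
  have inj: "inj ?f"
    using \<open>a \<noteq> 0\<close> by (simp add: inj_def)
  have surj: "surj ?f"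
    using \<open>a \<noteq> 0\<close> by (intro surjI[of _ "\<lambda>s. (s - of_real b) / of_real a"]) simp
  have compl: "?f ` (- range g) = - range (affine_contour a b g)"
    using bij_image_Compl_eq[of ?f "range g"] inj surj range_affine_contour[OF \<open>a \<noteq> 0\<close>, of b g]
    by (simp add: bij_def)
  have image: "connected_component (- range (affine_contour a b g)) (?f u) (?f v)"
    if "connected_component (- range g) u v" for u v
  proof -
    from that obtain T where T: "connected T" "T \<subseteq> - range g" "u \<in> T" "v \<in> T"
      by (auto simp: connected_component_def)
    have "connected (?f ` T)"
      by (intro connected_continuous_image continuous_intros T)
    then show ?thesis
      using T unfolding connected_component_def compl[symmetric] by blast
  qed
  \<comment> \<open>The point with real part \<open>x\<close> at height \<open>a * h\<close> comes
    from real part \<open>x / a - b / a\<close> at height \<open>h\<close>; this explains the map in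
    \<open>lim\<close>.\<close>
  have "?f (Complex (x / a - b / a) h) = Complex x (a * h)" for x
    using \<open>a \<noteq> 0\<close> by (simp add: complex_eq_iff field_simps)
  with eventually_compose_filterlim[OF ev lim] show ?thesis
    by (auto elim!: eventually_mono dest!: image)
qed

lemma sides_affine_pos:
  assumes "a > 0"
  shows "s \<in> left_side g h \<Longrightarrow> of_real a * s + of_real b \<in> left_side (affine_contour a b g) (a * h)"
    and "s \<in> right_side g h \<Longrightarrow> of_real a * s + of_real b \<in> right_side (affine_contour a b g) (a * h)"
proof -
  have "filterlim (\<lambda>x. x / a - b / a) at_bot at_bot" "filterlim (\<lambda>x. x / a - b / a) at_top at_top"
    using filterlim_affine_at_top_bot(1,2)[of "1 / a" "- b / a"] assms by simp_all
  note lims = this[THEN eventually_component_affine[rotated]]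
  show "s \<in> left_side g h \<Longrightarrow> of_real a * s + of_real b \<in> left_side (affine_contour a b g) (a * h)"
    "s \<in> right_side g h \<Longrightarrow> of_real a * s + of_real b \<in> right_side (affine_contour a b g) (a * h)"
    using lims assms unfolding left_side_def right_side_def by simp_all
qed

text \<open>Division by a negative \<open>a\<close> exchanges \<open>at_bot\<close> and
  \<open>at_top\<close>, so far left points of the reference line come from far right ones and the
  two sides swap.\<close>

lemma sides_affine_neg:
  assumes "a < 0"
  shows "s \<in> left_side g h \<Longrightarrow> of_real a * s + of_real b \<in> right_side (affine_contour a b g) (a * h)"
    and "s \<in> right_side g h \<Longrightarrow> of_real a * s + of_real b \<in> left_side (affine_contour a b g) (a * h)"
proof -
  have "filterlim (\<lambda>x. x / a - b / a) at_bot at_top" "filterlim (\<lambda>x. x / a - b / a) at_top at_bot"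
    using filterlim_affine_at_top_bot(3,4)[of "1 / a" "- b / a"] assms by simp_all
  note lims = this[THEN eventually_component_affine[rotated]]
  show "s \<in> left_side g h \<Longrightarrow> of_real a * s + of_real b \<in> right_side (affine_contour a b g) (a * h)"
    "s \<in> right_side g h \<Longrightarrow> of_real a * s + of_real b \<in> left_side (affine_contour a b g) (a * h)"
    using lims assms unfolding left_side_def right_side_def by simp_all
qed

text \<open>Compose with the inverse map \<open>(x - d) / c\<close>, which tends to \<open>s\<close>
  without attaining it near the limit point. This turns a pole of a transformed Gamma factor into a
  pole of the original one.\<close>

lemma is_pole_affine:
  fixes f :: "complex \<Rightarrow> complex"
  assumes "is_pole (\<lambda>s. f (c * s + d)) s" "c \<noteq> 0"
  shows "is_pole f (c * s + d)"
proof -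
  have "(\<lambda>x. (x - d) / c) \<midarrow>c * s + d\<rightarrow> s"
    using \<open>c \<noteq> 0\<close> by (auto intro!: tendsto_eq_intros)
  moreover have "\<forall>\<^sub>F x in at (c * s + d). (x - d) / c \<noteq> s"
    using \<open>c \<noteq> 0\<close> by (auto simp: eventually_at_filter field_simps)
  ultimately have "is_pole (\<lambda>x. f (c * ((x - d) / c) + d)) (c * s + d)"
    by (rule is_pole_compose[OF assms(1)])
  then show ?thesis
    using \<open>c \<noteq> 0\<close> by simp
qed

section \<open>The contour integral under affine substitutions\<close>

text \<open>\<open>vector_derivative\<close> is unspecified at corners of the contour. Each interval
  \<open>{- real n..real n}\<close> has only finitely many of them, so they form a countable set,
  which the integral ignores.\<close>

lemma negligible_not_differentiable_simple_contour:
  assumes "simple_contour g"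
  shows "negligible {\<tau>. \<not> g differentiable at \<tau>}"
proof -
  have "\<exists>S. finite S \<and> (\<forall>\<tau>\<in>{- real n..real n} - S. g differentiable at \<tau>)" for n
    using assms unfolding simple_contour_def piecewise_C1_differentiable_on_def
    by (meson C1_differentiable_on_eq)
  then obtain S where S: "\<And>n. finite (S n)"
      "\<And>n \<tau>. \<tau> \<in> {- real n..real n} - S n \<Longrightarrow> g differentiable at \<tau>"
    by metis
  have "{\<tau>. \<not> g differentiable at \<tau>} \<subseteq> (\<Union>n. S n)"
  proof
    fix \<tau> assume "\<tau> \<in> {\<tau>. \<not> g differentiable at \<tau>}"
    moreover have "\<tau> \<in> {- real (nat \<lceil>\<bar>\<tau>\<bar>\<rceil>)..real (nat \<lceil>\<bar>\<tau>\<bar>\<rceil>)}"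
      by (auto; linarith)
    ultimately show "\<tau> \<in> (\<Union>n. S n)"
      using S(2) by blast
  qed
  moreover have "negligible (\<Union>n. S n)"
    by (intro negligible_countable_Union) (auto simp: S(1) intro: negligible_finite)
  ultimately show ?thesis
    using negligible_subset by blast
qed

text \<open>Reflection is known on bounded intervals. The balls around 0 are symmetric, so the
  radius that works for \<open>f\<close> works for the reflected function too.\<close>

lemma has_integral_reflect_UNIV:
  fixes f :: "real \<Rightarrow> 'a::euclidean_space"
  assumes "(f has_integral I) UNIV"
  shows "((\<lambda>x. f (- x)) has_integral I) UNIV"
  unfolding has_integral_alt'
proof (intro conjI allI impI)
  fix a b :: real
  have "f integrable_on {- b..- a}"
    using assms by (auto simp: has_integral_alt')
  then show "(\<lambda>x. if x \<in> UNIV then f (- x) else 0) integrable_on cbox a b"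
    using Henstock_Kurzweil_Integration.integrable_reflect_real[where f = f and a = "- b" and b = "- a"] by simp
next
  fix e :: real assume "e > 0"
  then obtain B where "B > 0"
    and B: "\<And>a b. ball 0 B \<subseteq> cbox a b \<Longrightarrow> norm (integral {a..b} f - I) < e"
    using assms unfolding has_integral_alt' by auto
  have "norm (integral {a..b} (\<lambda>x. f (- x)) - I) < e" if "ball 0 B \<subseteq> cbox a b" for a b
  proof -
    have "ball 0 B \<subseteq> cbox (- b) (- a)"
    proof
      fix x :: real assume "x \<in> ball 0 B"
      then have "- x \<in> ball 0 B" by simp
      with that have "- x \<in> cbox a b" by blast
      then show "x \<in> cbox (- b) (- a)" by auto
    qed
    from B[OF this] show ?thesis
      using Henstock_Kurzweil_Integration.integral_reflect_real[where f = f and a = "- b" and b = "- a"] by simp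
  qed
  with \<open>B > 0\<close> show "\<exists>B>0. \<forall>a b. ball 0 B \<subseteq> cbox a b \<longrightarrow>
      norm (integral (cbox a b) (\<lambda>x. if x \<in> UNIV then f (- x) else 0) - I) < e"
    by (auto intro!: exI[of _ B])
qed

text \<open>Change of variables: the chain rule gives the factor
  \<open>a * sgn a = \<bar>a\<bar>\<close>, which is why the orientation leaves no sign.
  \<open>G\<close> is the integrand in the new variable and \<open>K\<close> collects what does not
  depend on it.\<close>

lemma has_integral_affine_contour:
  assumes int: "((\<lambda>\<tau>. F (g \<tau>) * vector_derivative g (at \<tau>)) has_integral I) UNIV"
    and g: "simple_contour g" and "a \<noteq> 0"
    and G: "\<And>s. G (of_real a * s + of_real b) = K * F s"
  shows "((\<lambda>\<tau>. G (affine_contour a b g \<tau>) * vector_derivative (affine_contour a b g) (at \<tau>))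
           has_integral (of_real \<bar>a\<bar> * K * I)) UNIV"
proof -
  have deriv: "vector_derivative (affine_contour a b g) (at \<tau>) =
      of_real \<bar>a\<bar> * vector_derivative g (at (sgn a * \<tau>))"
    if "g differentiable at (sgn a * \<tau>)" for \<tau>
  proof -
    have "(g has_vector_derivative vector_derivative g (at (sgn a * \<tau>))) (at (sgn a * \<tau>))"
      using that by (simp add: vector_derivative_works)
    moreover have "((\<lambda>\<tau>. sgn a * \<tau>) has_vector_derivative sgn a) (at \<tau>)"
      by (auto intro!: derivative_eq_intros simp: has_real_derivative_iff_has_vector_derivative[symmetric])
    ultimately have "((\<lambda>\<tau>. g (sgn a * \<tau>)) has_vector_derivative
        sgn a *\<^sub>R vector_derivative g (at (sgn a * \<tau>))) (at \<tau>)"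
      using vector_diff_chain_at[of "\<lambda>\<tau>. sgn a * \<tau>" "sgn a" \<tau> g] by (simp add: o_def)
    from has_vector_derivative_mult_right[OF this, of "of_real a"]
    have "((\<lambda>\<tau>. of_real a * g (sgn a * \<tau>) + of_real b) has_vector_derivative
        of_real a * (sgn a *\<^sub>R vector_derivative g (at (sgn a * \<tau>)))) (at \<tau>)"
      using has_vector_derivative_add[OF _ has_vector_derivative_const[of "of_real b"]] by fastforce
    then have "vector_derivative (affine_contour a b g) (at \<tau>) =
        of_real a * (sgn a *\<^sub>R vector_derivative g (at (sgn a * \<tau>)))"
      unfolding affine_contour_def by (rule vector_derivative_at)
    also have "\<dots> = of_real (a * sgn a) * vector_derivative g (at (sgn a * \<tau>))"
      by (simp add: scaleR_conv_of_real)
    finally show ?thesis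
      by (simp add: abs_sgn)
  qed
  let ?f = "\<lambda>\<tau>. G (affine_contour a b g \<tau>) * vector_derivative (affine_contour a b g) (at \<tau>)"
  have invol: "sgn a * (sgn a * \<tau>) = \<tau>" for \<tau>
    using \<open>a \<noteq> 0\<close> by (simp add: sgn_if)
  have "((\<lambda>\<tau>. of_real \<bar>a\<bar> * K * (F (g \<tau>) * vector_derivative g (at \<tau>)))
      has_integral of_real \<bar>a\<bar> * K * I) UNIV"
    using int by (rule has_integral_mult_right)
  \<comment> \<open>Evaluating at \<open>sgn a * \<tau>\<close> undoes the reversal, so
    \<open>g\<close> is taken at \<open>\<tau>\<close> itself and the exceptional set is exactly
    where \<open>g\<close> is not differentiable. The reversal is removed below by
    reflection.\<close>
  then have *: "((\<lambda>\<tau>. ?f (sgn a * \<tau>)) has_integral of_real \<bar>a\<bar> * K * I) UNIV"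
    by (rule has_integral_spike[OF negligible_not_differentiable_simple_contour[OF g], rotated])
      (use \<open>a \<noteq> 0\<close> in \<open>simp add: deriv G invol affine_contour_def[of a b g, THEN fun_cong]\<close>)
  show ?thesis
    using * has_integral_reflect_UNIV[OF *] \<open>a \<noteq> 0\<close> by (cases "a > 0") simp_all
qed

section \<open>Transformation of the H-function\<close>

text \<open>
  The substitution \<open>s = c s'' + d\<close> in the integral with parameters \<open>\<alpha>, A, \<beta>, B\<close>, so that
  contours are transformed by \<open>s \<mapsto> (s - d) / c\<close>.
\<close>

locale fox_affine =
  fixes m n p q :: nat and \<alpha> \<beta> \<alpha>'' \<beta>'' :: "nat \<Rightarrow> complex" and A B A'' B'' :: "nat \<Rightarrow> real"
    and c d :: real
  assumes c_pos: "c > 0"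
    and upper: "\<And>j. j \<in> {1..p} \<Longrightarrow> \<alpha>'' j = \<alpha> j + of_real d * of_real (A j) \<and> A'' j = c * A j"
    and lower: "\<And>j. j \<in> {1..q} \<Longrightarrow> \<beta>'' j = \<beta> j + of_real d * of_real (B j) \<and> B'' j = c * B j"
begin

lemma fox_params:
  assumes "fox_params m n p q \<alpha> A \<beta> B"
  shows "fox_params m n p q \<alpha>'' A'' \<beta>'' B''"
  unfolding fox_params_def
proof (intro conjI ballI allI)
  fix j j' l l' :: nat
  assume j: "j \<in> {1..n}" "j' \<in> {1..m}"
  then have "of_real (A j) * (of_nat l + \<beta> j') \<noteq> of_real (B j') * (\<alpha> j - of_nat l' - 1)"
    using assms by (auto simp: fox_params_def)
  \<comment> \<open>The shifts contribute the same term, a multiple of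
    \<open>d * A j * B j'\<close>, to both products and cancel; only the factor \<open>c\<close>
    remains.\<close>
  moreover have "of_real (A'' j) * (of_nat l + \<beta>'' j') - of_real (B'' j') * (\<alpha>'' j - of_nat l' - 1) =
      of_real c * (of_real (A j) * (of_nat l + \<beta> j') - of_real (B j') * (\<alpha> j - of_nat l' - 1))"
    using upper[of j] lower[of j'] j assms by (simp add: fox_params_def algebra_simps)
  ultimately show "of_real (A'' j) * (of_nat l + \<beta>'' j') \<noteq>
      of_real (B'' j') * (\<alpha>'' j - of_nat l' - 1)"
    using c_pos by auto
qed (use assms upper lower c_pos in \<open>auto simp: fox_params_def\<close>)

lemma Gamma_args:
  shows "j \<in> {1..q} \<Longrightarrow> \<beta>'' j + of_real (B'' j) * s = \<beta> j + of_real (B j) * (of_real c * s + of_real d)"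
    and "j \<in> {1..p} \<Longrightarrow> \<alpha>'' j + of_real (A'' j) * s = \<alpha> j + of_real (A j) * (of_real c * s + of_real d)"
    and "j \<in> {1..q} \<Longrightarrow>
      1 - \<beta>'' j - of_real (B'' j) * s = 1 - \<beta> j - of_real (B j) * (of_real c * s + of_real d)"
    and "j \<in> {1..p} \<Longrightarrow>
      1 - \<alpha>'' j - of_real (A'' j) * s = 1 - \<alpha> j - of_real (A j) * (of_real c * s + of_real d)"
  using upper[of j] lower[of j] by (simp_all add: algebra_simps)

lemma fox_Xi:
  assumes "n \<le> p" "m \<le> q"
  shows "fox_Xi m n p q \<alpha>'' A'' \<beta>'' B'' s = fox_Xi m n p q \<alpha> A \<beta> B (of_real c * s + of_real d)"
  unfolding fox_Xi_def
  by (intro arg_cong2[of _ _ _ _ "(/)"] arg_cong2[of _ _ _ _ "(*)"] prod.cong refl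
      arg_cong[of _ _ Gamma] Gamma_args) (use assms in auto)

text \<open>A pole \<open>s\<close> of a new factor gives a pole \<open>c * s + d\<close> of the old
  one, whose side of \<open>g\<close> is known. The contour map is the inverse substitution and
  keeps sides because \<open>c > 0\<close>.\<close>

lemma separates_poles:
  assumes "n \<le> p" "m \<le> q" and sep: "separates_poles m n \<alpha> A \<beta> B g h"
  shows "separates_poles m n \<alpha>'' A'' \<beta>'' B'' (affine_contour (1 / c) (- d / c) g) (h / c)"
  unfolding separates_poles_def
proof (intro conjI ballI allI impI)
  have s: "of_real (1 / c) * (of_real c * s + of_real d) + of_real (- d / c) = s" for s :: complex
    using c_pos by (simp add: field_simps)
  fix j s
  show "s \<in> left_side (affine_contour (1 / c) (- d / c) g) (h / c)"
    if j: "j \<in> {1..m}" and pole: "is_pole (\<lambda>s. Gamma (\<beta>'' j + of_real (B'' j) * s)) s"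
  proof -
    have "is_pole (\<lambda>s. Gamma (\<beta> j + of_real (B j) * (of_real c * s + of_real d))) s"
      using pole j assms(2) by (simp add: Gamma_args)
    then have "is_pole (\<lambda>s. Gamma (\<beta> j + of_real (B j) * s)) (of_real c * s + of_real d)"
      using c_pos by (intro is_pole_affine) auto
    then have "of_real c * s + of_real d \<in> left_side g h"
      using sep j by (auto simp: separates_poles_def)
    from sides_affine_pos(1)[OF _ this, of "1 / c" "- d / c"] show ?thesis
      using c_pos unfolding s by simp
  qed
  show "s \<in> right_side (affine_contour (1 / c) (- d / c) g) (h / c)"
    if j: "j \<in> {1..n}" and pole: "is_pole (\<lambda>s. Gamma (1 - \<alpha>'' j - of_real (A'' j) * s)) s"
  proof -
    have "is_pole (\<lambda>s. Gamma (1 - \<alpha> j - of_real (A j) * (of_real c * s + of_real d))) s"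
      using pole j assms(1) by (simp add: Gamma_args)
    then have "is_pole (\<lambda>s. Gamma (1 - \<alpha> j - of_real (A j) * s)) (of_real c * s + of_real d)"
      using c_pos by (intro is_pole_affine) auto
    then have "of_real c * s + of_real d \<in> right_side g h"
      using sep j by (auto simp: separates_poles_def)
    from sides_affine_pos(2)[OF _ this, of "1 / c" "- d / c"] show ?thesis
      using c_pos unfolding s by simp
  qed
qed

lemma fox_contour:
  assumes "n \<le> p" "m \<le> q" and g: "fox_contour m n \<alpha> A \<beta> B g"
  shows "fox_contour m n \<alpha>'' A'' \<beta>'' B'' (affine_contour (1 / c) (- d / c) g)"
proof -
  let ?g = "affine_contour (1 / c) (- d / c) g"
  have "simple_contour ?g"
    using g c_pos by (auto simp: fox_contour_def intro: simple_contour_affine)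
  moreover have "vertical_ends ?g (1 / c * \<gamma> + - d / c)" if "vertical_ends g \<gamma>" for \<gamma>
    using that c_pos by (intro vertical_ends_affine) auto
  moreover have "left_loop_ends ?g (1 / c * \<phi>1) (1 / c * \<phi>2)" if "left_loop_ends g \<phi>1 \<phi>2" for \<phi>1 \<phi>2
    using that c_pos by (intro left_loop_ends_affine) auto
  moreover have "right_loop_ends ?g (1 / c * \<phi>1) (1 / c * \<phi>2)" if "right_loop_ends g \<phi>1 \<phi>2" for \<phi>1 \<phi>2
    using that c_pos by (intro right_loop_ends_affine) auto
  \<comment> \<open>The reference height of a loop, the mean of its end heights, scales with the
    contour; for a vertical contour height 0 is kept.\<close>
  moreover have "(1 / c * \<phi>1 + 1 / c * \<phi>2) / 2 = (\<phi>1 + \<phi>2) / 2 / c" for \<phi>1 \<phi>2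
    by (simp add: add_divide_distrib)
  ultimately show ?thesis
    using g separates_poles[OF assms(1,2), of g] unfolding fox_contour_def
    by (metis div_0)
qed

text \<open>For \<open>z > 0\<close> all logarithms are real, so z^(-(s - d)/c) splits as z^(d/c)
  times (z^(1/c))^(-s) without branch issues. The remaining factor 1/c comes from the change of
  variables.\<close>

lemma has_fox_H:
  assumes "z > 0" "has_fox_H m n p q \<alpha> A \<beta> B (z powr (1 / c)) w"
  shows "has_fox_H m n p q \<alpha>'' A'' \<beta>'' B'' z (of_real (z powr (d / c) / c) * w)"
proof -
  from assms obtain g I where par: "fox_params m n p q \<alpha> A \<beta> B"
    and g: "fox_contour m n \<alpha> A \<beta> B g"
    and int: "((\<lambda>\<tau>. fox_Xi m n p q \<alpha> A \<beta> B (g \<tau>) * of_real (z powr (1 / c)) powr (- g \<tau>) *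
              vector_derivative g (at \<tau>)) has_integral I) UNIV"
    and w: "w = 1 / (2 * of_real pi * \<i>) * I"
    by (auto simp: has_fox_H_def)
  from par have le: "n \<le> p" "m \<le> q"
    by (auto simp: fox_params_def)
  have "fox_Xi m n p q \<alpha>'' A'' \<beta>'' B'' (of_real (1 / c) * s + of_real (- d / c)) *
        of_real z powr (- (of_real (1 / c) * s + of_real (- d / c))) =
      of_real (z powr (d / c)) *
        (fox_Xi m n p q \<alpha> A \<beta> B s * of_real (z powr (1 / c)) powr (- s))" for s
  proof -
    have "of_real c * (of_real (1 / c) * s + of_real (- d / c)) + of_real d = s"
      using c_pos by (simp add: field_simps)
    moreover have "of_real z powr (- (of_real (1 / c) * s + of_real (- d / c))) =
        of_real (z powr (d / c)) * of_real (z powr (1 / c)) powr (- s)"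
      using \<open>z > 0\<close> c_pos
      by (simp add: powr_def Ln_of_real ln_powr exp_of_real[symmetric] exp_add[symmetric]
          add_divide_distrib diff_divide_distrib ring_distribs)
    ultimately show ?thesis
      by (simp add: fox_Xi[OF le])
  qed
  from has_integral_affine_contour[OF int _ _ this, simplified] g c_pos
  have "((\<lambda>\<tau>. fox_Xi m n p q \<alpha>'' A'' \<beta>'' B'' (affine_contour (1 / c) (- d / c) g \<tau>) *
          of_real z powr (- affine_contour (1 / c) (- d / c) g \<tau>) *
          vector_derivative (affine_contour (1 / c) (- d / c) g) (at \<tau>))
        has_integral (of_real (z powr (d / c) / c) * I)) UNIV"
    by (simp add: fox_contour_def)
  with assms(1) fox_params[OF par] fox_contour[OF le g] show ?thesis
    unfolding has_fox_H_def w
    by (auto intro!: exI[of _ "affine_contour (1 / c) (- d / c) g"]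
        exI[of _ "of_real (z powr (d / c) / c) * I"])
qed

end

section \<open>The reflection of the integration variable\<close>

text \<open>Negating \<open>s\<close> exchanges the upper and lower lists along with their lengths,
  whereas \<open>fox_affine\<close> keeps both in place; hence a separate locale.\<close>

locale fox_reflection =
  fixes m n p q :: nat and \<alpha> \<beta> \<alpha>'' \<beta>'' :: "nat \<Rightarrow> complex" and A B A'' B'' :: "nat \<Rightarrow> real"
  assumes upper: "\<And>j. j \<in> {1..q} \<Longrightarrow> \<alpha>'' j = 1 - \<beta> j \<and> A'' j = B j"
    and lower: "\<And>j. j \<in> {1..p} \<Longrightarrow> \<beta>'' j = 1 - \<alpha> j \<and> B'' j = A j"
begin

lemma fox_params:
  assumes "fox_params m n p q \<alpha> A \<beta> B"
  shows "fox_params n m q p \<alpha>'' A'' \<beta>'' B''"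
  unfolding fox_params_def
proof (intro conjI ballI allI)
  fix j j' l l' :: nat
  assume j: "j \<in> {1..m}" "j' \<in> {1..n}"
  then have "of_real (A j') * (of_nat l' + \<beta> j) \<noteq> of_real (B j) * (\<alpha> j' - of_nat l - 1)"
    using assms by (auto simp: fox_params_def)
  \<comment> \<open>The old condition reappears with the roles of \<open>l\<close> and
    \<open>l'\<close> exchanged.\<close>
  moreover have "of_real (A'' j) * (of_nat l + \<beta>'' j') - of_real (B'' j') * (\<alpha>'' j - of_nat l' - 1) =
      of_real (A j') * (of_nat l' + \<beta> j) - of_real (B j) * (\<alpha> j' - of_nat l - 1)"
  proof -
    have eqs: "\<alpha>'' j = 1 - \<beta> j" "A'' j = B j" "\<beta>'' j' = 1 - \<alpha> j'" "B'' j' = A j'"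
      using upper[of j] lower[of j'] j assms by (auto simp: fox_params_def)
    show ?thesis
      unfolding eqs by (simp add: algebra_simps)
  qed
  ultimately show "of_real (A'' j) * (of_nat l + \<beta>'' j') \<noteq>
      of_real (B'' j') * (\<alpha>'' j - of_nat l' - 1)"
    by auto
qed (use assms upper lower in \<open>auto simp: fox_params_def\<close>)

lemma Gamma_args:
  shows "j \<in> {1..p} \<Longrightarrow> \<beta>'' j + of_real (B'' j) * s = 1 - \<alpha> j - of_real (A j) * (- s)"
    and "j \<in> {1..q} \<Longrightarrow> \<alpha>'' j + of_real (A'' j) * s = 1 - \<beta> j - of_real (B j) * (- s)"
    and "j \<in> {1..p} \<Longrightarrow> 1 - \<beta>'' j - of_real (B'' j) * s = \<alpha> j + of_real (A j) * (- s)"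
    and "j \<in> {1..q} \<Longrightarrow> 1 - \<alpha>'' j - of_real (A'' j) * s = \<beta> j + of_real (B j) * (- s)"
  using upper[of j] lower[of j] by (simp_all add: algebra_simps)

lemma fox_Xi:
  assumes "n \<le> p" "m \<le> q"
  shows "fox_Xi n m q p \<alpha>'' A'' \<beta>'' B'' s = fox_Xi m n p q \<alpha> A \<beta> B (- s)"
proof -
  have "(\<Prod>j=1..n. Gamma (\<beta>'' j + of_real (B'' j) * s)) = (\<Prod>j=1..n. Gamma (1 - \<alpha> j - of_real (A j) * (- s)))"
    "(\<Prod>j=1..m. Gamma (1 - \<alpha>'' j - of_real (A'' j) * s)) = (\<Prod>j=1..m. Gamma (\<beta> j + of_real (B j) * (- s)))"
    "(\<Prod>j=n+1..p. Gamma (1 - \<beta>'' j - of_real (B'' j) * s)) = (\<Prod>j=n+1..p. Gamma (\<alpha> j + of_real (A j) * (- s)))"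
    "(\<Prod>j=m+1..q. Gamma (\<alpha>'' j + of_real (A'' j) * s)) = (\<Prod>j=m+1..q. Gamma (1 - \<beta> j - of_real (B j) * (- s)))"
    by (intro prod.cong refl arg_cong[of _ _ Gamma] Gamma_args; (use assms in auto))+
  then show ?thesis
    unfolding fox_Xi_def by (simp only: mult.commute)
qed

lemma separates_poles:
  assumes "n \<le> p" "m \<le> q" and sep: "separates_poles m n \<alpha> A \<beta> B g h"
  shows "separates_poles n m \<alpha>'' A'' \<beta>'' B'' (affine_contour (- 1) 0 g) (- h)"
  unfolding separates_poles_def
proof (intro conjI ballI allI impI)
  fix j s
  show "s \<in> left_side (affine_contour (- 1) 0 g) (- h)"
    if j: "j \<in> {1..n}" and pole: "is_pole (\<lambda>s. Gamma (\<beta>'' j + of_real (B'' j) * s)) s"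
  proof -
    \<comment> \<open>The argument is written as \<open>- 1 * s + 0\<close> to match the pattern
      \<open>c * s + d\<close> of \<open>is_pole_affine\<close>.\<close>
    have "is_pole (\<lambda>s. Gamma (1 - \<alpha> j - of_real (A j) * (- 1 * s + 0))) s"
      using pole j assms(1) by (simp add: Gamma_args)
    from is_pole_affine[OF this] have "- s \<in> right_side g h"
      using sep j by (auto simp: separates_poles_def)
    from sides_affine_neg(2)[OF _ this, of "- 1" 0] show ?thesis
      by simp
  qed
  show "s \<in> right_side (affine_contour (- 1) 0 g) (- h)"
    if j: "j \<in> {1..m}" and pole: "is_pole (\<lambda>s. Gamma (1 - \<alpha>'' j - of_real (A'' j) * s)) s"
  proof -
    have "is_pole (\<lambda>s. Gamma (\<beta> j + of_real (B j) * (- 1 * s + 0))) s"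
      using pole j assms(2) by (simp add: Gamma_args)
    from is_pole_affine[OF this] have "- s \<in> left_side g h"
      using sep j by (auto simp: separates_poles_def)
    from sides_affine_neg(1)[OF _ this, of "- 1" 0] show ?thesis
      by simp
  qed
qed

lemma fox_contour:
  assumes "n \<le> p" "m \<le> q" and g: "fox_contour m n \<alpha> A \<beta> B g"
  shows "fox_contour n m \<alpha>'' A'' \<beta>'' B'' (affine_contour (- 1) 0 g)"
proof -
  let ?g = "affine_contour (- 1) 0 g"
  have "simple_contour ?g"
    using g by (auto simp: fox_contour_def intro: simple_contour_affine)
  moreover have "vertical_ends ?g (- \<gamma>)" if "vertical_ends g \<gamma>" for \<gamma>
    using vertical_ends_affine[OF that, of "- 1" 0] by simp
  moreover have "right_loop_ends ?g (- \<phi>2) (- \<phi>1)" if "left_loop_ends g \<phi>1 \<phi>2" for \<phi>1 \<phi>2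
    using left_loop_ends_affine(2)[OF that, of "- 1" 0] by simp
  moreover have "left_loop_ends ?g (- \<phi>2) (- \<phi>1)" if "right_loop_ends g \<phi>1 \<phi>2" for \<phi>1 \<phi>2
    using right_loop_ends_affine(2)[OF that, of "- 1" 0] by simp
  \<comment> \<open>The reflected loop is centred at the negated height, as
    \<open>separates_poles\<close> delivers; height 0 of vertical contours is fixed.\<close>
  moreover have "(- \<phi>2 + - \<phi>1) / 2 = - ((\<phi>1 + \<phi>2) / 2)" for \<phi>1 \<phi>2 :: real
    by (simp add: field_simps)
  ultimately show ?thesis
    using g separates_poles[OF assms(1,2), of g] unfolding fox_contour_def
    by (metis neg_equal_0_iff_equal)
qed

text \<open>Reflection turns z^(-s) into z^s = (1/z)^(-s), and the change of variables contributes
  only the factor 1.\<close>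

lemma has_fox_H:
  assumes "z > 0" "has_fox_H m n p q \<alpha> A \<beta> B (1 / z) w"
  shows "has_fox_H n m q p \<alpha>'' A'' \<beta>'' B'' z w"
proof -
  from assms obtain g I where par: "fox_params m n p q \<alpha> A \<beta> B"
    and g: "fox_contour m n \<alpha> A \<beta> B g"
    and int: "((\<lambda>\<tau>. fox_Xi m n p q \<alpha> A \<beta> B (g \<tau>) * of_real (1 / z) powr (- g \<tau>) *
              vector_derivative g (at \<tau>)) has_integral I) UNIV"
    and w: "w = 1 / (2 * of_real pi * \<i>) * I"
    unfolding has_fox_H_def by blast
  from par have le: "n \<le> p" "m \<le> q"
    by (auto simp: fox_params_def)
  have "fox_Xi n m q p \<alpha>'' A'' \<beta>'' B'' (of_real (- 1) * s + of_real 0) *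
        of_real z powr (- (of_real (- 1) * s + of_real 0)) =
      1 * (fox_Xi m n p q \<alpha> A \<beta> B s * of_real (1 / z) powr (- s))" for s
  proof -
    have "of_real z powr s = of_real (1 / z) powr (- s)"
      using \<open>z > 0\<close> unfolding powr_def by (subst (1 2) Ln_of_real) (simp_all add: ln_div)
    then show ?thesis
      by (simp add: fox_Xi[OF le])
  qed
  from has_integral_affine_contour[OF int _ _ this] g
  have "((\<lambda>\<tau>. fox_Xi n m q p \<alpha>'' A'' \<beta>'' B'' (affine_contour (- 1) 0 g \<tau>) *
          of_real z powr (- affine_contour (- 1) 0 g \<tau>) *
          vector_derivative (affine_contour (- 1) 0 g) (at \<tau>)) has_integral I) UNIV"
    by (simp add: fox_contour_def)
  with assms(1) fox_params[OF par] fox_contour[OF le g] show ?thesis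
    unfolding has_fox_H_def w by blast
qed

end

section \<open>Transfer of definedness and positivity\<close>

text \<open>Definedness is unique existence, so both directions enter: \<open>fwd\<close> produces a
  value, and \<open>bwd\<close> sends any value back to the unique one of the given function.
  Multiplication by the positive real \<open>k t\<close> preserves the sign.\<close>

lemma fox_H_positive_transfer:
  fixes \<alpha>' \<beta>' \<alpha>'' \<beta>'' A' B' A'' B'' :: "nat \<Rightarrow> real"
  assumes pos: "fox_H_positive m' n' p' q' \<alpha>' A' \<beta>' B'"
    and u: "\<And>t. t > 0 \<Longrightarrow> u t > 0" and k: "\<And>t. t > 0 \<Longrightarrow> k t > 0"
    and fwd: "\<And>t w. t > 0 \<Longrightarrow> has_fox_H m' n' p' q' \<alpha>' A' \<beta>' B' (u t) w \<Longrightarrow>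
      has_fox_H m'' n'' p'' q'' \<alpha>'' A'' \<beta>'' B'' t (of_real (k t) * w)"
    and bwd: "\<And>t w. t > 0 \<Longrightarrow> has_fox_H m'' n'' p'' q'' \<alpha>'' A'' \<beta>'' B'' t w \<Longrightarrow>
      has_fox_H m' n' p' q' \<alpha>' A' \<beta>' B' (u t) (w / of_real (k t))"
  shows "fox_H_positive m'' n'' p'' q'' \<alpha>'' A'' \<beta>'' B''"
  unfolding fox_H_positive_def
proof (intro allI impI)
  fix t :: real assume "t > 0"
  note u = u[OF this] and k = k[OF this] and fwd = fwd[OF this] and bwd = bwd[OF this]
  let ?H' = "has_fox_H m' n' p' q' \<alpha>' A' \<beta>' B' (u t)"
  let ?H'' = "has_fox_H m'' n'' p'' q'' \<alpha>'' A'' \<beta>'' B'' t"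
  from pos u have ex1: "\<exists>!w. ?H' w" and "0 < (THE w. ?H' w)"
    by (auto simp: fox_H_positive_def fox_H_defined_def fox_H_def)
  then obtain w where w: "?H' w" "0 < w"
    by (metis theI')
  have uniq: "v = of_real (k t) * w" if "?H'' v" for v
  proof -
    have "v / of_real (k t) = w"
      using bwd[OF that] w(1) ex1 by blast
    then show ?thesis
      using k by (auto simp: field_simps)
  qed
  with fwd[OF w(1)] have "\<exists>!v. ?H'' v" "(THE v. ?H'' v) = of_real (k t) * w"
    by (blast, blast intro: the_equality)
  moreover have "0 < of_real (k t) * w"
    using k w(2) by (simp add: less_complex_def)
  ultimately show "fox_H_defined m'' n'' p'' q'' \<alpha>'' A'' \<beta>'' B'' t \<and>
      0 < fox_H m'' n'' p'' q'' \<alpha>'' A'' \<beta>'' B'' t"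
    by (simp add: fox_H_defined_def fox_H_def)
qed

lemma fox_H_positive_affine:
  fixes \<alpha>' \<beta>' \<alpha>'' \<beta>'' A' B' A'' B'' :: "nat \<Rightarrow> real"
  assumes "fox_H_positive m n p q \<alpha>' A' \<beta>' B'" and "c > 0"
    and upper: "\<And>j. j \<in> {1..p} \<Longrightarrow> \<alpha>'' j = \<alpha>' j + d * A' j \<and> A'' j = c * A' j"
    and lower: "\<And>j. j \<in> {1..q} \<Longrightarrow> \<beta>'' j = \<beta>' j + d * B' j \<and> B'' j = c * B' j"
  shows "fox_H_positive m n p q \<alpha>'' A'' \<beta>'' B''"
proof -
  interpret fwd: fox_affine m n p q \<alpha>' \<beta>' \<alpha>'' \<beta>'' A' B' A'' B'' c d
    using assms by unfold_locales auto
  \<comment> \<open>Solving \<open>s = c * s'' + d\<close> for \<open>s''\<close> gives a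
    substitution of the same kind, with \<open>1 / c\<close> and \<open>- d / c\<close>.\<close>
  interpret bwd: fox_affine m n p q \<alpha>'' \<beta>'' \<alpha>' \<beta>' A'' B'' A' B' "1 / c" "- d / c"
    using assms by unfold_locales auto
  show ?thesis
  proof (rule fox_H_positive_transfer[OF assms(1)])
    fix t :: real and w assume "t > 0"
    then show "has_fox_H m n p q \<alpha>'' A'' \<beta>'' B'' t (of_real (t powr (d / c) / c) * w)"
      if "has_fox_H m n p q \<alpha>' A' \<beta>' B' (t powr (1 / c)) w"
      using fwd.has_fox_H that by blast
    have "(t powr (1 / c)) powr (1 / (1 / c)) = t"
      using \<open>t > 0\<close> \<open>c > 0\<close> by (simp add: powr_powr)
    then have bwd: "has_fox_H m n p q \<alpha>' A' \<beta>' B' (t powr (1 / c))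
        (of_real ((t powr (1 / c)) powr (- d / c / (1 / c)) / (1 / c)) * w)"
      if "has_fox_H m n p q \<alpha>'' A'' \<beta>'' B'' t w"
      using bwd.has_fox_H[of "t powr (1 / c)" w] that \<open>t > 0\<close> by simp
    \<comment> \<open>The factor of the inverse substitution, taken at
      \<open>t powr (1 / c)\<close>, is the reciprocal of the forward factor at
      \<open>t\<close>.\<close>
    have "(t powr (1 / c)) powr (- d / c / (1 / c)) / (1 / c) = inverse (t powr (d / c) / c)"
      using \<open>c > 0\<close> by (simp add: powr_powr powr_minus field_simps)
    then show "has_fox_H m n p q \<alpha>' A' \<beta>' B' (t powr (1 / c)) (w / of_real (t powr (d / c) / c))"
      if "has_fox_H m n p q \<alpha>'' A'' \<beta>'' B'' t w"
      using bwd[OF that] by (simp only: of_real_inverse divide_inverse mult.commute)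
  qed (use \<open>c > 0\<close> in simp_all)
qed

lemma fox_H_positive_reflection:
  fixes \<alpha>' \<beta>' \<alpha>'' \<beta>'' A' B' A'' B'' :: "nat \<Rightarrow> real"
  assumes "fox_H_positive m n p q \<alpha>' A' \<beta>' B'"
    and upper: "\<And>j. j \<in> {1..q} \<Longrightarrow> \<alpha>'' j = 1 - \<beta>' j \<and> A'' j = B' j"
    and lower: "\<And>j. j \<in> {1..p} \<Longrightarrow> \<beta>'' j = 1 - \<alpha>' j \<and> B'' j = A' j"
  shows "fox_H_positive n m q p \<alpha>'' A'' \<beta>'' B''"
proof -
  interpret fwd: fox_reflection m n p q \<alpha>' \<beta>' \<alpha>'' \<beta>'' A' B' A'' B''
    using assms by unfold_locales auto
  \<comment> \<open>Since 1 - (1 - x) = x, the reflection is an involution, and the same locale also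
    yields the converse.\<close>
  interpret bwd: fox_reflection n m q p \<alpha>'' \<beta>'' \<alpha>' \<beta>' A'' B'' A' B'
    using assms by unfold_locales auto
  show ?thesis
  proof (rule fox_H_positive_transfer[OF assms(1), where k = "\<lambda>_. 1"])
    fix t :: real and w assume "t > 0"
    then show "has_fox_H n m q p \<alpha>'' A'' \<beta>'' B'' t (of_real 1 * w)"
      if "has_fox_H m n p q \<alpha>' A' \<beta>' B' (1 / t) w"
      using fwd.has_fox_H that by simp
    show "has_fox_H m n p q \<alpha>' A' \<beta>' B' (1 / t) (w / of_real 1)"
      if "has_fox_H n m q p \<alpha>'' A'' \<beta>'' B'' t w"
      using bwd.has_fox_H[of "1 / t" w] that \<open>t > 0\<close> by simp
  qed simp_all
qed

section \<open>The three parameter changes\<close>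

theorem corollary5p1:
  fixes m' n' p' q' m'' n'' p'' q'' :: nat
    and \<alpha>' A' \<beta>' B' \<alpha>'' A'' \<beta>'' B'' :: "nat \<Rightarrow> real"
    and \<omega> :: real
  assumes A'_pos: "\<forall>j\<in>{1..p'}. A' j > 0"
    and B'_pos: "\<forall>j\<in>{1..q'}. B' j > 0"
    and H'_pos: "fox_H_positive m' n' p' q' \<alpha>' A' \<beta>' B'"
    and \<omega>_pos: "\<omega> > 0"
    and conditions:
      "(m'' = n' \<and> n'' = m' \<and> p'' = q' \<and> q'' = p' \<and>
          (\<forall>j\<in>{1..q'}. \<alpha>'' j = 1 - \<beta>' j \<and> A'' j = B' j) \<and>
          (\<forall>j\<in>{1..p'}. \<beta>'' j = 1 - \<alpha>' j \<and> B'' j = A' j)) \<or>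
       (m'' = m' \<and> n'' = n' \<and> p'' = p' \<and> q'' = q' \<and>
          (\<forall>j\<in>{1..p'}. \<alpha>'' j = \<alpha>' j \<and> A'' j = \<omega> * A' j) \<and>
          (\<forall>j\<in>{1..q'}. \<beta>'' j = \<beta>' j \<and> B'' j = \<omega> * B' j)) \<or>
       (m'' = m' \<and> n'' = n' \<and> p'' = p' \<and> q'' = q' \<and>
          (\<exists>\<sigma>\<in>{1, -1}.
             (\<forall>j\<in>{1..p'}. \<alpha>'' j = \<alpha>' j + \<sigma> * \<omega> * A' j \<and> A'' j = A' j) \<and>
             (\<forall>j\<in>{1..q'}. \<beta>'' j = \<beta>' j + \<sigma> * \<omega> * B' j \<and> B'' j = B' j)))"
  shows "fox_H_positive m'' n'' p'' q'' \<alpha>'' A'' \<beta>'' B''"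
  using conditions
proof (elim disjE conjE)
  assume "m'' = n'" "n'' = m'" "p'' = q'" "q'' = p'"
    "\<forall>j\<in>{1..q'}. \<alpha>'' j = 1 - \<beta>' j \<and> A'' j = B' j"
    "\<forall>j\<in>{1..p'}. \<beta>'' j = 1 - \<alpha>' j \<and> B'' j = A' j"
  then show ?thesis
    using fox_H_positive_reflection[OF H'_pos, of \<alpha>'' A'' \<beta>'' B''] by simp
next
  assume "m'' = m'" "n'' = n'" "p'' = p'" "q'' = q'"
    "\<forall>j\<in>{1..p'}. \<alpha>'' j = \<alpha>' j \<and> A'' j = \<omega> * A' j"
    "\<forall>j\<in>{1..q'}. \<beta>'' j = \<beta>' j \<and> B'' j = \<omega> * B' j"
  \<comment> \<open>Pure scaling: \<open>c = \<omega>\<close> and \<open>d = 0\<close>.\<close>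
  then show ?thesis
    using fox_H_positive_affine[OF H'_pos \<omega>_pos, of \<alpha>'' 0 A'' \<beta>'' B''] by simp
next
  assume eqs: "m'' = m'" "n'' = n'" "p'' = p'" "q'' = q'"
    and "\<exists>\<sigma>\<in>{1, - 1}.
      (\<forall>j\<in>{1..p'}. \<alpha>'' j = \<alpha>' j + \<sigma> * \<omega> * A' j \<and> A'' j = A' j) \<and>
      (\<forall>j\<in>{1..q'}. \<beta>'' j = \<beta>' j + \<sigma> * \<omega> * B' j \<and> B'' j = B' j)"
  then obtain \<sigma> :: real where
    "\<forall>j\<in>{1..p'}. \<alpha>'' j = \<alpha>' j + \<sigma> * \<omega> * A' j \<and> A'' j = A' j"
    "\<forall>j\<in>{1..q'}. \<beta>'' j = \<beta>' j + \<sigma> * \<omega> * B' j \<and> B'' j = B' j"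
    by blast
  \<comment> \<open>Pure translation: \<open>c = 1\<close> and
    \<open>d = \<sigma> * \<omega>\<close>, so both signs are covered by one real shift.\<close>
  then show ?thesis
    using eqs fox_H_positive_affine[OF H'_pos, of 1 \<alpha>'' "\<sigma> * \<omega>" A'' \<beta>'' B''] by simp
qed

end
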